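(* Let $N\ge 1$. Every $123$-avoiding permutation in $\mathfrak{S}_N$ has at most two left-to-right maxima; exactly $C_{N-1}$ of them have exactly one left-to-right maximum and exactly $C_N-C_{N-1}$ have exactly two. Consequently the expected number of left-to-right maxima of a uniformly random $123$-avoiding permutation in $\mathfrak{S}_N$ is $2-\frac{C_{N-1}}{C_N}$, and the win probability of the strategy-indifferent game of best choice of rank $N+1$ whose bine of competitors is the set of $123$-avoiding permutations in $\mathfrak{S}_N$ tends to $4/11$ as $N\to\infty$.
   Context: $\mathfrak{S}_n$ is the set of permutations of $\{1,\dots,n\}$ in one-line notation; $C_n=\frac{1}{n+1}\binom{2n}{n}$ is the $n$th Catalan number. A permutation avoids a pattern $\rho\in\mathfrak{S}_3$ if it has no (not necessarily consecutive) subsequence of length 3 with the same relative order as $\rho$. An entry $\pi_j$ is a left-to-right maximum if $\pi_i<\pi_j$ for all $i<j$; then $j$ is a left-to-right maximum position. The flattening of a sequence of $i$ distinct integers is the unique permutation of $\{1,\dots,i\}$ with the same relative order; $\pi|_{[i]}$ denotes the flattening of $\pi_1,\dots,\pi_i$. Game of best choice of rank $n$ defined by a nonempty finite multiset $\mathcal{I}$ of elements of $\mathfrak{S}_n$: $\pi\in\mathcal{I}$ is chosen uniformly at random (with multiplicity) and $\pi|_{[1]},\pi|_{[2]},\dots$ are presented sequentially. A strategy is given by a strike set $A$ of prefixes: the player stops at the first $i$ with $\pi|_{[i]}\in A$, and wins if and only if such $i$ exists and $\pi_i=n$. The prefix tree $\mathcal{P}_n$ is the set of permutations in $\bigcup_{i=1}^n\mathfrak{S}_i$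 whose last entry is a left-to-right maximum, ordered by: $q$ contains $p$ if $q|_{[i]}=p$, where $i$ is the size of $p$. A maximal antichain of $\mathcal{P}_n$ is a set of pairwise incomparable elements such that every element of $\mathcal{P}_n$ is comparable to some element of it. The game is strategy-indifferent if all strike sets that are maximal antichains of $\mathcal{P}_n$ have the same probability of winning, called the win probability. For a finite nonempty multiset $\mathcal{J}'$ of elements of $\mathfrak{S}_{n-1}$, a strategy-indifferent game of rank $n$ with bine of competitors $\mathcal{J}'$ is a multiset $\mathcal{I}$ constructed as follows: let $\mathcal{J}$ be obtained by appending $n$ to each element of $\mathcal{J}'$; for each $\pi\in\mathcal{J}$ and each left-to-right maximum position $i$ of $\pi$, include in $\mathcal{I}$ one permutation $\widetilde\pi\in\mathfrak{S}_n$ with $\widetilde\pi|_{[i]}=\pi|_{[i]}$ and $\widetilde\pi_i=n$ (arbitrary choice; the win probability does not depend on the choices). *)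

theory Defs
  imports
    "HOL-Combinatorics.Multiset_Permutations"
    "HOL-Library.Sublist"
    "HOL-Probability.Probability"
begin

section \<open>Permutations in one-line notation\<close>

abbreviation perms :: "nat \<Rightarrow> nat list set" where
  "perms n \<equiv> permutations_of_set {1..n}"

text \<open>Positions are counted from 1, whereas list indexing starts at 0.\<close>

definition entry :: "nat list \<Rightarrow> nat \<Rightarrow> nat" where
  "entry \<pi> j = \<pi> ! (j - 1)"

definition flattening :: "nat list \<Rightarrow> nat list" where
  "flattening xs = map (\<lambda>x. card {y \<in> set xs. y \<le> x}) xs"

definition flat_prefix :: "nat list \<Rightarrow> nat \<Rightarrow> nat list" where
  "flat_prefix \<pi> i = flattening (take i \<pi>)"

definition contains_pattern :: "nat list \<Rightarrow> nat list \<Rightarrow> bool" where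
  "contains_pattern \<pi> \<rho> \<longleftrightarrow> (\<exists>xs. subseq xs \<pi> \<and> flattening xs = \<rho>)"

definition avoiders :: "nat \<Rightarrow> nat list \<Rightarrow> nat list set" where
  "avoiders n \<rho> = {\<pi> \<in> perms n. \<not> contains_pattern \<pi> \<rho>}"

definition lr_max_positions :: "nat list \<Rightarrow> nat set" where
  "lr_max_positions \<pi> = {j \<in> {1..length \<pi>}. \<forall>i\<in>{1..<j}. entry \<pi> i < entry \<pi> j}"

abbreviation num_lr_max :: "nat list \<Rightarrow> nat" where
  "num_lr_max \<pi> \<equiv> card (lr_max_positions \<pi>)"

definition catalan :: "nat \<Rightarrow> real" where
  "catalan n = 1 / (real n + 1) * real ((2 * n) choose n)"

section \<open>Games of best choice\<close>

definition best_choice_game :: "nat \<Rightarrow> nat list multiset \<Rightarrow> bool" where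
  "best_choice_game n \<I> \<longleftrightarrow> \<I> \<noteq> {#} \<and> set_mset \<I> \<subseteq> perms n"

definition wins :: "nat \<Rightarrow> nat list set \<Rightarrow> nat list \<Rightarrow> bool" where
  "wins n A \<pi> \<longleftrightarrow>
     (\<exists>i\<in>{1..n}. flat_prefix \<pi> i \<in> A \<and> (\<forall>j\<in>{1..<i}. flat_prefix \<pi> j \<notin> A) \<and> entry \<pi> i = n)"

definition strike_prob :: "nat \<Rightarrow> nat list multiset \<Rightarrow> nat list set \<Rightarrow> real" where
  "strike_prob n \<I> A = measure_pmf.prob (pmf_of_multiset \<I>) {\<pi>. wins n A \<pi>}"

definition prefix_tree :: "nat \<Rightarrow> nat list set" where
  "prefix_tree n = {p. \<exists>i\<in>{1..n}. p \<in> perms i \<and> i \<in> lr_max_positions p}"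

definition contains_prefix :: "nat list \<Rightarrow> nat list \<Rightarrow> bool" where
  "contains_prefix q p \<longleftrightarrow> length p \<le> length q \<and> flat_prefix q (length p) = p"

definition comparable :: "nat list \<Rightarrow> nat list \<Rightarrow> bool" where
  "comparable p q \<longleftrightarrow> contains_prefix q p \<or> contains_prefix p q"

definition maximal_antichain :: "nat \<Rightarrow> nat list set \<Rightarrow> bool" where
  "maximal_antichain n A \<longleftrightarrow>
     A \<subseteq> prefix_tree n \<and>
     (\<forall>p\<in>A. \<forall>q\<in>A. p \<noteq> q \<longrightarrow> \<not> comparable p q) \<and>
     (\<forall>q\<in>prefix_tree n. \<exists>p\<in>A. comparable p q)"

definition strategy_indifferent :: "nat \<Rightarrow> nat list multiset \<Rightarrow> bool" where
  "strategy_indifferent n \<I> \<longleftrightarrow> best_choice_game n \<I> \<and>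
     (\<forall>A B. maximal_antichain n A \<longrightarrow> maximal_antichain n B \<longrightarrow>
        strike_prob n \<I> A = strike_prob n \<I> B)"

text \<open>Only meaningful for strategy-indifferent games.\<close>

definition win_probability :: "nat \<Rightarrow> nat list multiset \<Rightarrow> real" where
  "win_probability n \<I> = (THE w. \<forall>A. maximal_antichain n A \<longrightarrow> strike_prob n \<I> A = w)"

section \<open>Games with a given bine of competitors\<close>

text \<open>All pairs of an element of a multiset and one of its left-to-right maximum positions,
  counted with the multiplicity of the element.\<close>

definition lr_max_pairs :: "nat list multiset \<Rightarrow> (nat list \<times> nat) multiset" where
  "lr_max_pairs \<J> = (\<Sum>\<pi>\<in>#\<J>. image_mset (Pair \<pi>) (mset_set (lr_max_positions \<pi>)))"

definition insertable :: "nat \<Rightarrow> nat list \<times> nat \<Rightarrow> nat list \<Rightarrow> bool" where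
  "insertable n = (\<lambda>(\<pi>, i) \<sigma>. \<sigma> \<in> perms n \<and> flat_prefix \<sigma> i = flat_prefix \<pi> i \<and> entry \<sigma> i = n)"

text \<open>The multiset relator expresses that \<open>\<I>\<close> arises by choosing one permutation for each
  occurrence of a pair, the choices being independent of one another.\<close>

definition bine_game :: "nat \<Rightarrow> nat list multiset \<Rightarrow> nat list multiset \<Rightarrow> bool" where
  "bine_game n \<J>' \<I> \<longleftrightarrow>
     \<J>' \<noteq> {#} \<and> set_mset \<J>' \<subseteq> perms (n - 1) \<and>
     rel_mset (insertable n) (lr_max_pairs (image_mset (\<lambda>\<pi>. \<pi> @ [n]) \<J>')) \<I>"

text \<open>Such games exist: the required choices are always possible.\<close>

lemma flattening_map:
  assumes "strict_mono_on (set xs) f"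
  shows "flattening (map f xs) = flattening xs"
proof -
  have "card {y \<in> f ` set xs. y \<le> f x} = card {y \<in> set xs. y \<le> x}" if "x \<in> set xs" for x
  proof -
    have "{y \<in> f ` set xs. y \<le> f x} = f ` {y \<in> set xs. y \<le> x}"
      using assms that strict_mono_on_less_eq[OF assms] by auto
    moreover have "inj_on f {y \<in> set xs. y \<le> x}"
      using strict_mono_on_imp_inj_on[OF assms] by (rule inj_on_subset) auto
    ultimately show ?thesis by (simp add: card_image)
  qed
  then show ?thesis by (simp add: flattening_def)
qed

lemma insertable_exists:
  assumes "\<pi> \<in> perms n" "i \<in> lr_max_positions \<pi>"
  shows "\<exists>\<sigma>. insertable n (\<pi>, i) \<sigma>"
proof -
  define m where "m = entry \<pi> i"
  define f where "f x = (if x = m then n else if x > m then x - 1 else x)" for x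
  have s: "set \<pi> = {1..n}" and d: "distinct \<pi>"
    using assms(1) by (auto simp: permutations_of_set_def)
  have i: "i \<in> {1..length \<pi>}" and mx: "\<And>j. j \<in> {1..<i} \<Longrightarrow> entry \<pi> j < m"
    using assms(2) by (auto simp: lr_max_positions_def m_def)
  have "m \<in> set \<pi>" using i by (auto simp: m_def entry_def)
  then have m: "m \<in> {1..n}" using s by simp
  have inj: "inj_on f {1..n}"
    using m by (auto simp: inj_on_def f_def)
  have "f ` {1..n} \<subseteq> {1..n}" using m by (auto simp: f_def)
  then have im: "f ` {1..n} = {1..n}"
    using inj by (simp add: endo_inj_surj)
  have le: "x \<le> m" if "x \<in> set (take i \<pi>)" for x
  proof -
    from that obtain k where k: "k < i" "k < length \<pi>" "x = \<pi> ! k"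
      by (auto simp: in_set_conv_nth)
    show ?thesis
    proof (cases "Suc k = i")
      case True
      then show ?thesis using k by (auto simp: m_def entry_def)
    next
      case False
      then show ?thesis using k mx[of "Suc k"] by (auto simp: entry_def)
    qed
  qed
  have "strict_mono_on (set (take i \<pi>)) f"
    using le m by (intro strict_mono_onI) (fastforce simp: f_def)
  then have "flat_prefix (map f \<pi>) i = flat_prefix \<pi> i"
    by (simp add: flat_prefix_def take_map flattening_map)
  moreover have "entry (map f \<pi>) i = n"
    using i by (auto simp: entry_def f_def m_def)
  moreover have "map f \<pi> \<in> perms n"
    using inj im s d by (auto simp: permutations_of_set_def distinct_map)
  ultimately show ?thesis by (auto simp: insertable_def)
qed

lemma finite_lr_max_positions: "finite (lr_max_positions \<pi>)"
  by (simp add: lr_max_positions_def)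

lemma bine_game_exists:
  assumes "n \<ge> 1" "\<J>' \<noteq> {#}" "set_mset \<J>' \<subseteq> perms (n - 1)"
  shows "\<exists>\<I>. bine_game n \<J>' \<I>"
proof -
  define K where "K = lr_max_pairs (image_mset (\<lambda>\<pi>. \<pi> @ [n]) \<J>')"
  have "\<exists>\<sigma>. insertable n x \<sigma>" if xK: "x \<in># K" for x
  proof -
    obtain \<pi> i where x: "x = (\<pi> @ [n], i)" "\<pi> \<in># \<J>'" "i \<in> lr_max_positions (\<pi> @ [n])"
      using xK by (auto simp: K_def lr_max_pairs_def finite_lr_max_positions)
    have "\<pi> \<in> perms (n - 1)" using assms x by auto
    then have "\<pi> @ [n] \<in> perms n"
      using assms(1) by (auto simp: permutations_of_set_def)
    then show ?thesis using insertable_exists x by blast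
  qed
  then obtain g where "\<And>x. x \<in># K \<Longrightarrow> insertable n x (g x)" by metis
  then have "rel_mset (insertable n) K (image_mset g K)"
    by (simp add: multiset.rel_map multiset.rel_refl_strong)
  then show ?thesis using assms by (auto simp: bine_game_def K_def)
qed

end

theory Submission
  imports Defs "HOL-Real_Asymp.Real_Asymp"
begin

text \<open>The maximum of a permutation can be inserted into a 123-avoider of rank \<open>n\<close> exactly at the
  sites within its initial descending run. Counting avoiders by a lower bound \<open>k\<close> on the length of
  this run therefore gives a recursion, solved by the ballot numbers; \<open>k = 0\<close> gives \<open>C\<^sub>n\<close>.
  An avoider has a single left-to-right maximum iff it starts with its maximum, which may then be
  deleted.

  In a game with bine of competitors \<open>\<J>'\<close>, a maximal antichain contains exactly one prefix of each
  competitor (with \<open>n\<close> appended), so exactly one of the permutations derived from this competitor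
  is won. Hence every such strike set wins with probability \<open>|\<J>'| / |\<I>|\<close>, which for 123-avoiders
  is \<open>1 / (3 - C\<^bsub>N-1\<^esub> / C\<^sub>N)\<close>.\<close>

declare One_nat_def [simp del]

section \<open>Avoidance of 123\<close>

text \<open>Recursive in the first entry and over any linear order, so that induction can follow the
  insertion of a maximum; \<open>contains_123_iff\<close> ties it to the pattern definition.\<close>

fun avoids_123 :: "'a::linorder list \<Rightarrow> bool" where
  "avoids_123 [] \<longleftrightarrow> True"
| "avoids_123 (x # xs) \<longleftrightarrow> sorted_wrt (\<lambda>b c. \<not> (x < b \<and> b < c)) xs \<and> avoids_123 xs"

lemma sorted_wrt_iff_subseq: "sorted_wrt P xs \<longleftrightarrow> (\<forall>b c. subseq [b, c] xs \<longrightarrow> P b c)"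
proof (induction xs)
  case (Cons x xs)
  show ?case
  proof
    assume "sorted_wrt P (x # xs)"
    with Cons.IH show "\<forall>b c. subseq [b, c] (x # xs) \<longrightarrow> P b c"
      by (auto simp: subseq_singleton_left split: if_splits)
  next
    assume P: "\<forall>b c. subseq [b, c] (x # xs) \<longrightarrow> P b c"
    then have "\<forall>c\<in>set xs. P x c"
      by (auto simp: subseq_singleton_left)
    moreover have "P b c" if "subseq [b, c] xs" for b c
      using P list_emb_Cons[OF that, of x] by blast
    ultimately show "sorted_wrt P (x # xs)"
      using Cons.IH by simp
  qed
qed simp

lemma avoids_123_iff_subseq:
  "avoids_123 xs \<longleftrightarrow> (\<forall>a b c. subseq [a, b, c] xs \<longrightarrow> \<not> (a < b \<and> b < c))"
proof (induction xs)
  case (Cons x xs)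
  show ?case
  proof
    assume "avoids_123 (x # xs)"
    with Cons.IH show "\<forall>a b c. subseq [a, b, c] (x # xs) \<longrightarrow> \<not> (a < b \<and> b < c)"
      by (auto simp: sorted_wrt_iff_subseq simp del: subseq_Cons2_iff)
         (metis subseq_Cons2_iff)+
  next
    assume P: "\<forall>a b c. subseq [a, b, c] (x # xs) \<longrightarrow> \<not> (a < b \<and> b < c)"
    then have "\<forall>b c. subseq [b, c] xs \<longrightarrow> \<not> (x < b \<and> b < c)"
      by (metis subseq_Cons2_iff)
    moreover have "\<not> (a < b \<and> b < c)" if "subseq [a, b, c] xs" for a b c
      using P list_emb_Cons[OF that, of x] by blast
    ultimately show "avoids_123 (x # xs)"
      using Cons.IH by (simp add: sorted_wrt_iff_subseq)
  qed
qed simp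

lemma flattening_eq_123_iff:
  "flattening xs = [1, 2, 3] \<longleftrightarrow> (\<exists>a b c. xs = [a, b, c] \<and> a < b \<and> b < c)"
proof
  assume L: "flattening xs = [1, 2, 3]"
  then have "length xs = 3"
    by (auto simp: flattening_def dest: arg_cong[where f = length])
  then obtain a b c where xs: "xs = [a, b, c]"
    by (auto simp: numeral_3_eq_3 length_Suc_conv)
  define r where "r x = card {y \<in> {a, b, c}. y \<le> x}" for x
  have "r a = 1" "r b = 2" "r c = 3"
    using L by (simp_all add: xs flattening_def r_def)
  \<comment> \<open>Rank is weakly monotone in the entry, so a smaller rank forces a smaller
    entry.\<close>
  moreover have "x < y" if "r x < r y" for x y
  proof (rule ccontr)
    assume "\<not> x < y"
    then have "r y \<le> r x"
      unfolding r_def by (intro card_mono) auto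
    with that show False by simp
  qed
  ultimately have "a < b" "b < c" by simp_all
  with xs show "\<exists>a b c. xs = [a, b, c] \<and> a < b \<and> b < c" by blast
next
  assume "\<exists>a b c. xs = [a, b, c] \<and> a < b \<and> b < c"
  then obtain a b c where *: "xs = [a, b, c]" "a < b" "b < c" by blast
  then have "{y. (y = a \<or> y = b \<or> y = c) \<and> y \<le> a} = {a}"
    "{y. (y = a \<or> y = b \<or> y = c) \<and> y \<le> b} = {a, b}"
    "{y. (y = a \<or> y = b \<or> y = c) \<and> y \<le> c} = {a, b, c}" by auto
  with * show "flattening xs = [1, 2, 3]"
    by (simp add: flattening_def)
qed

lemma contains_123_iff: "contains_pattern \<pi> [1, 2, 3] \<longleftrightarrow> \<not> avoids_123 \<pi>"
  unfolding contains_pattern_def flattening_eq_123_iff avoids_123_iff_subseq by blast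

text \<open>An entry exceeding all others can only play the 3 of a pattern 123, so the new
  occurrences come from the ascending pairs in front of it.\<close>

lemma avoids_123_insert_max:
  assumes "\<forall>x\<in>set (xs @ ys). x < m"
  shows "avoids_123 (xs @ m # ys) \<longleftrightarrow> sorted_wrt (\<ge>) xs \<and> avoids_123 (xs @ ys)"
  using assms
proof (induction xs)
  case Nil
  then have "sorted_wrt (\<lambda>b c. \<not> (m < b \<and> b < c)) ys"
    by (auto simp: sorted_wrt_iff_nth_less dest: nth_mem)
      (meson dual_order.strict_trans2 not_less nth_mem order_less_imp_le order_less_trans)
  then show ?case by simp
next
  case (Cons x xs)
  have "(\<forall>b\<in>set xs. \<not> (x < b \<and> b < m)) \<longleftrightarrow> (\<forall>b\<in>set xs. b \<le> x)"
    using Cons.prems by (auto simp: not_less)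
  moreover have "\<forall>c\<in>set ys. \<not> (x < m \<and> m < c)"
    using Cons.prems by (auto dest: less_asym)
  ultimately show ?case
    using Cons by (auto simp: sorted_wrt_append)
qed

section \<open>Counting 123-avoiding permutations\<close>

text \<open>Entries are distinct, so the condition means strict descent. Only a lower bound on the
  run is imposed, hence the sets shrink as \<open>k\<close> grows.\<close>

definition run_avoiders :: "nat \<Rightarrow> nat \<Rightarrow> nat list set" where
  "run_avoiders n k = {\<pi> \<in> perms n. avoids_123 \<pi> \<and> sorted_wrt (\<ge>) (take k \<pi>)}"

lemma avoiders_eq_run_avoiders: "avoiders n [1, 2, 3] = run_avoiders n 0"
  by (auto simp: avoiders_def run_avoiders_def contains_123_iff)

lemma finite_run_avoiders: "finite (run_avoiders n k)"
  by (simp add: run_avoiders_def)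

lemma perms_iff: "\<pi> \<in> perms n \<longleftrightarrow> set \<pi> = {1..n} \<and> distinct \<pi>"
  by (auto simp: permutations_of_set_def)

lemma length_perms: "\<pi> \<in> perms n \<Longrightarrow> length \<pi> = n"
  by (auto simp: perms_iff dest: distinct_card)

lemma insert_max_perms_iff:
  assumes "Suc n \<notin> set (xs @ ys)"
  shows "xs @ Suc n # ys \<in> perms (Suc n) \<longleftrightarrow> xs @ ys \<in> perms n"
proof -
  have "insert (Suc n) A = {1..Suc n} \<longleftrightarrow> A = {1..n}" if "Suc n \<notin> A" for A
  proof -
    have "{1..Suc n} = insert (Suc n) {1..n}" by auto
    with that show ?thesis
      by (metis insert_ident atLeastAtMost_iff not_less_eq_eq order_refl)
  qed
  from this[of "set (xs @ ys)"] assms show ?thesis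
    unfolding perms_iff by auto
qed

text \<open>In front, the maximum lengthens the descending run by one. At a site
  \<open>j > 0\<close> it ends the run of the result after exactly \<open>j\<close> entries, which
  must themselves descend to avoid 123; hence the alternative \<open>k < j\<close>.\<close>

lemma insert_max_run_avoiders_iff:
  assumes \<rho>: "\<rho> \<in> perms n" and j: "j \<le> n"
  shows "take j \<rho> @ Suc n # drop j \<rho> \<in> run_avoiders (Suc n) (Suc k) \<longleftrightarrow>
    j = 0 \<and> \<rho> \<in> run_avoiders n k \<or> k < j \<and> \<rho> \<in> run_avoiders n j"
proof -
  let ?\<pi> = "take j \<rho> @ Suc n # drop j \<rho>"
  have less: "x < Suc n" if "x \<in> set \<rho>" for x
    using that \<rho> by (auto simp: perms_iff)
  have len: "length \<rho> = n" using \<rho> by (rule length_perms)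
  have "?\<pi> \<in> perms (Suc n)"
    using \<rho> less by (subst insert_max_perms_iff) (auto dest: in_set_takeD in_set_dropD)
  moreover have "avoids_123 ?\<pi> \<longleftrightarrow> sorted_wrt (\<ge>) (take j \<rho>) \<and> avoids_123 \<rho>"
    using less by (subst avoids_123_insert_max) (auto dest: in_set_takeD in_set_dropD)
  ultimately have \<pi>: "?\<pi> \<in> run_avoiders (Suc n) (Suc k) \<longleftrightarrow>
    \<rho> \<in> run_avoiders n j \<and> sorted_wrt (\<ge>) (take (Suc k) ?\<pi>)"
    using \<rho> by (auto simp: run_avoiders_def)
  consider "j = 0" | "k < j" | "0 < j" "j \<le> k" by linarith
  then show ?thesis
  proof cases
    case 1
    then show ?thesis unfolding \<pi> using \<rho> less
      by (auto simp: run_avoiders_def dest!: in_set_takeD intro!: less_imp_le)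
  next
    case 2
    have "sorted_wrt (\<ge>) (take (Suc k) \<rho>)" if "sorted_wrt (\<ge>) (take j \<rho>)"
      using sorted_wrt_take[OF that, of "Suc k"] 2 by (simp add: min_absorb1)
    with 2 len j show ?thesis unfolding \<pi>
      by (auto simp: run_avoiders_def min_absorb1)
  next
    \<comment> \<open>The first \<open>k + 1\<close> entries now include the maximum preceded by a
      smaller entry \<open>x\<close>, which breaks the descent.\<close>
    case 3
    then have "\<rho> \<noteq> []" using len j by auto
    then obtain x where "x \<in> set (take j \<rho>)" "x \<in> set \<rho>"
      using 3 by (metis in_set_takeD less_numeral_extra(3) list.set_sel(1) take_eq_Nil)
    moreover have "take (Suc k) ?\<pi> = take j \<rho> @ Suc n # take (k - j) (drop j \<rho>)"
      using 3 len j by (simp add: Suc_diff_le)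
    ultimately have "\<not> sorted_wrt (\<ge>) (take (Suc k) ?\<pi>)"
      using less[of x] by (simp only: sorted_wrt_append) (auto simp: not_le)
    with 3 show ?thesis unfolding \<pi> by auto
  qed
qed

text \<open>Deleting the maximum inverts the insertion, so counting by the remaining permutation and
  the site leaves one term for the front and one for each site beyond \<open>k\<close>.\<close>

lemma card_run_avoiders_Suc:
  assumes "k \<le> n"
  shows "card (run_avoiders (Suc n) (Suc k)) = (\<Sum>i=k..n. card (run_avoiders n i))"
proof -
  \<comment> \<open>The front is always a candidate, while site \<open>k\<close> itself is excluded
    for \<open>k > 0\<close>; the summation index \<open>k\<close> is therefore free to stand for
    the front.\<close>
  define site where "site i = (if i = k then 0 else i)" for i
  define g where "g = (\<lambda>(i, \<rho>). take (site i) \<rho> @ Suc n # drop (site i) \<rho>)"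
  have \<rho>: "\<rho> \<in> perms n" "length \<rho> = n" "Suc n \<notin> set \<rho>" if "\<rho> \<in> run_avoiders n i" for \<rho> i
    using that by (auto simp: run_avoiders_def perms_iff length_perms)
  have site: "site i \<le> n" if "i \<le> n" for i
    using that by (simp add: site_def)
  have "bij_betw g (SIGMA i:{k..n}. run_avoiders n i) (run_avoiders (Suc n) (Suc k))"
  proof (rule bij_betw_imageI)
    show "inj_on g (SIGMA i:{k..n}. run_avoiders n i)"
    proof (rule inj_onI, clarify)
      fix i \<rho> j \<sigma>
      assume *: "i \<in> {k..n}" "j \<in> {k..n}" "\<rho> \<in> run_avoiders n i" "\<sigma> \<in> run_avoiders n j"
        and "g (i, \<rho>) = g (j, \<sigma>)"
      then have "take (site i) \<rho> @ Suc n # drop (site i) \<rho> = take (site j) \<sigma> @ Suc n # drop (site j) \<sigma>"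
        by (simp add: g_def)
      moreover have "Suc n \<notin> set (take (site i) \<rho>)" "Suc n \<notin> set (drop (site i) \<rho>)"
        using \<rho>(3)[OF *(3)] by (auto dest: in_set_takeD in_set_dropD)
      ultimately have eq: "take (site i) \<rho> = take (site j) \<sigma>" "drop (site i) \<rho> = drop (site j) \<sigma>"
        by (simp_all add: append_Cons_eq_iff)
      then have "\<rho> = \<sigma>" by (metis append_take_drop_id)
      moreover have "site i = site j"
        using arg_cong[OF eq(1), of length] * \<rho>(2)[OF *(3)] \<rho>(2)[OF *(4)] site[of i] site[of j]
        by (simp add: min_absorb1 min_absorb2)
      then have "i = j" using * by (auto simp: site_def split: if_splits)
      ultimately show "i = j \<and> \<rho> = \<sigma>" by simp
    qed
    show "g ` (SIGMA i:{k..n}. run_avoiders n i) = run_avoiders (Suc n) (Suc k)"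
    proof (intro equalityI subsetI)
      fix \<pi> assume "\<pi> \<in> g ` (SIGMA i:{k..n}. run_avoiders n i)"
      then obtain i \<rho> where *: "\<pi> = g (i, \<rho>)" "i \<in> {k..n}" "\<rho> \<in> run_avoiders n i" by auto
      with insert_max_run_avoiders_iff[OF \<rho>(1)[OF *(3)] site, of i k]
      show "\<pi> \<in> run_avoiders (Suc n) (Suc k)"
        by (auto simp: g_def site_def split: if_splits)
    next
      fix \<pi> assume \<pi>: "\<pi> \<in> run_avoiders (Suc n) (Suc k)"
      then have p: "\<pi> \<in> perms (Suc n)" by (simp add: run_avoiders_def)
      then have "Suc n \<in> set \<pi>" by (auto simp: perms_iff)
      then obtain xs ys where xy: "\<pi> = xs @ Suc n # ys" by (auto dest: split_list)
      define \<rho> where "\<rho> = xs @ ys"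
      have "Suc n \<notin> set (xs @ ys)" using p by (auto simp: perms_iff xy)
      with p have \<rho>p: "\<rho> \<in> perms n" by (simp add: insert_max_perms_iff xy \<rho>_def)
      have len: "length xs \<le> n" using length_perms[OF \<rho>p] by (simp add: \<rho>_def)
      have \<pi>eq: "\<pi> = take (length xs) \<rho> @ Suc n # drop (length xs) \<rho>" by (simp add: \<rho>_def xy)
      then have "length xs = 0 \<and> \<rho> \<in> run_avoiders n k \<or>
        k < length xs \<and> \<rho> \<in> run_avoiders n (length xs)"
        using insert_max_run_avoiders_iff[OF \<rho>p len, of k] \<pi> by simp
      then have "\<exists>i\<in>{k..n}. site i = length xs \<and> \<rho> \<in> run_avoiders n i"
      proof (elim disjE)
        assume "length xs = 0 \<and> \<rho> \<in> run_avoiders n k"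
        then show ?thesis using assms by (intro bexI[of _ k]) (auto simp: site_def)
      next
        assume "k < length xs \<and> \<rho> \<in> run_avoiders n (length xs)"
        then show ?thesis using len by (intro bexI[of _ "length xs"]) (auto simp: site_def)
      qed
      then show "\<pi> \<in> g ` (SIGMA i:{k..n}. run_avoiders n i)"
        using \<pi>eq by (force simp: g_def)
    qed
  qed
  then have "card (SIGMA i:{k..n}. run_avoiders n i) = card (run_avoiders (Suc n) (Suc k))"
    by (rule bij_betw_same_card)
  then show ?thesis by (simp add: finite_run_avoiders)
qed

text \<open>The ballot numbers in reflection form: for \<open>k \<le> n\<close>, the count of
  lattice paths with \<open>n\<close> up and \<open>n - k\<close> down steps that never fall below
  their start. Real values keep the difference from being truncated.\<close>

definition ballot :: "nat \<Rightarrow> nat \<Rightarrow> real" where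
  "ballot n k = real ((2 * n - k) choose n) - real ((2 * n - k) choose Suc n)"

text \<open>Pascal's rule, applied to both binomials.\<close>

lemma ballot_Suc_diff:
  assumes "k \<le> n"
  shows "ballot (Suc n) (Suc k) - ballot (Suc n) (Suc (Suc k)) = ballot n k"
proof -
  have "2 * Suc n - Suc k = Suc (2 * n - k)" "2 * Suc n - Suc (Suc k) = 2 * n - k"
    using assms by auto
  then show ?thesis by (simp add: ballot_def)
qed

text \<open>Pascal's rule, followed by the symmetry of the two middle binomials of row
  \<open>2 * n + 1\<close>.\<close>

lemma ballot_Suc_0: "ballot (Suc n) 0 = ballot (Suc n) (Suc 0)"
proof -
  have "Suc (2 * n) choose n = Suc (2 * n) choose Suc n"
    by (subst binomial_symmetric) auto
  then show ?thesis by (simp add: ballot_def)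
qed

lemma sum_ballot:
  assumes "k \<le> n"
  shows "(\<Sum>i=k..n. ballot n i) = ballot (Suc n) (Suc k)"
proof -
  have "(\<Sum>i=k..n. ballot n i) = (\<Sum>i=k..n. ballot (Suc n) (Suc i) - ballot (Suc n) (Suc (Suc i)))"
    by (intro sum.cong) (simp_all add: ballot_Suc_diff)
  also have "\<dots> = ballot (Suc n) (Suc k) - ballot (Suc n) (Suc (Suc n))"
    using sum_Suc_diff[of k n "\<lambda>i. - ballot (Suc n) (Suc i)"] assms by simp
  \<comment> \<open>The upper end of the telescoping sum vanishes: both binomials choose more than
    the \<open>n\<close> available elements.\<close>
  also have "ballot (Suc n) (Suc (Suc n)) = 0"
    by (simp add: ballot_def binomial_eq_0)
  finally show ?thesis by simp
qed

lemma card_run_avoiders: "k \<le> n \<Longrightarrow> real (card (run_avoiders n k)) = ballot n k"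
proof (induction n arbitrary: k)
  case 0
  have "run_avoiders 0 0 = {[]}" by (auto simp: run_avoiders_def)
  with 0 show ?case by (simp add: ballot_def)
next
  case (Suc n)
  have *: "real (card (run_avoiders (Suc n) (Suc k))) = ballot (Suc n) (Suc k)" if "k \<le> n" for k
    using that Suc.IH by (simp add: card_run_avoiders_Suc sum_ballot)
  show ?case
  proof (cases k)
    case 0
    \<comment> \<open>The recursion only reaches bounds \<open>Suc k\<close>; the bound 0 agrees
      with the bound 1, as a single entry always descends.\<close>
    have "sorted_wrt (\<ge>) (take (Suc 0) xs)" for xs :: "nat list"
      by (cases xs) auto
    then have "run_avoiders (Suc n) 0 = run_avoiders (Suc n) (Suc 0)"
      by (simp add: run_avoiders_def)
    then show ?thesis using *[of 0] by (simp add: 0 ballot_Suc_0)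
  next
    case (Suc k')
    then show ?thesis using *[of k'] \<open>k \<le> Suc n\<close> by simp
  qed
qed

lemma ballot_0: "ballot n 0 = catalan n"
proof (cases n)
  case 0
  then show ?thesis by (simp add: ballot_def catalan_def)
next
  case (Suc m)
  \<comment> \<open>The second binomial is \<open>n / (n + 1)\<close> times the central one, so the
    difference keeps the fraction \<open>1 / (n + 1)\<close> of it.\<close>
  have "Suc n * ((2 * n) choose Suc n) = n * ((2 * n) choose n)"
    using Suc_times_binomial_add[of n m] by (simp add: Suc mult_2)
  then have "real (Suc n) * real ((2 * n) choose Suc n) = real n * real ((2 * n) choose n)"
    by (metis of_nat_mult)
  then show ?thesis
    by (simp add: ballot_def catalan_def field_simps)
qed

lemma card_avoiders: "real (card (avoiders n [1, 2, 3])) = catalan n"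
  using card_run_avoiders[of 0 n] by (simp only: avoiders_eq_run_avoiders ballot_0 le0)

section \<open>Ratio of consecutive Catalan numbers\<close>

lemma catalan_pos: "catalan n > 0"
  by (simp add: catalan_def)

text \<open>Two absorption steps, with the middle symmetry between them, relate consecutive central
  binomials; the factors \<open>1 / (n + 1)\<close> and \<open>1 / (n + 2)\<close> then give the
  linear coefficients.\<close>

lemma catalan_Suc: "(real n + 2) * catalan (Suc n) = (4 * real n + 2) * catalan n"
proof -
  have sym: "Suc (2 * n) choose n = Suc (2 * n) choose Suc n"
    by (subst binomial_symmetric) auto
  have "Suc n * ((2 * Suc n) choose Suc n) = (2 * n + 2) * (Suc (2 * n) choose n)"
    using Suc_times_binomial[of n "Suc (2 * n)"] by simp
  also have "\<dots> = 2 * (Suc n * (Suc (2 * n) choose Suc n))"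
    by (simp only: sym) (simp add: algebra_simps)
  also have "\<dots> = 2 * (Suc (2 * n) * ((2 * n) choose n))"
    by (simp only: Suc_times_binomial)
  finally have "real (Suc n) * real ((2 * Suc n) choose Suc n)
      = 2 * (real (Suc (2 * n)) * real ((2 * n) choose n))"
    by (metis of_nat_mult of_nat_numeral)
  then show ?thesis
    unfolding catalan_def by (simp add: field_simps del: binomial_Suc_Suc)
qed

lemma catalan_ratio_tendsto: "(\<lambda>N. catalan (N - 1) / catalan N) \<longlonglongrightarrow> 1 / 4"
proof -
  have "catalan n / catalan (Suc n) = (real n + 2) / (4 * real n + 2)" for n
    using catalan_Suc[of n] catalan_pos[of "Suc n"] by (simp add: field_simps)
  moreover have "(\<lambda>n. (real n + 2) / (4 * real n + 2)) \<longlonglongrightarrow> 1 / 4"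
    by real_asymp
  ultimately have "(\<lambda>n. catalan (Suc n - 1) / catalan (Suc n)) \<longlonglongrightarrow> 1 / 4" by simp
  then show ?thesis by (rule LIMSEQ_imp_Suc)
qed

section \<open>Left-to-right maxima of 123-avoiding permutations\<close>

lemma one_in_lr_max_positions: "\<pi> \<noteq> [] \<Longrightarrow> 1 \<in> lr_max_positions \<pi>"
  by (cases \<pi>) (auto simp: lr_max_positions_def)

lemma num_lr_max_pos: "\<pi> \<noteq> [] \<Longrightarrow> num_lr_max \<pi> \<ge> 1"
  using one_in_lr_max_positions finite_lr_max_positions
  by (metis One_nat_def Suc_leI card_gt_0_iff empty_iff)

text \<open>Position 1 is always a left-to-right maximum of a nonempty list; two more would form a
  123 together with the first entry.\<close>

lemma num_lr_max_le_2:
  assumes "avoids_123 \<pi>"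
  shows "num_lr_max \<pi> \<le> 2"
proof -
  have False if ij: "i \<in> lr_max_positions \<pi> - {1}" "j \<in> lr_max_positions \<pi> - {1}" "i < j" for i j
  proof -
    obtain x xs where \<pi>: "\<pi> = x # xs"
      using ij by (cases \<pi>) (auto simp: lr_max_positions_def)
    have "1 < i" "j \<le> length \<pi>" "entry \<pi> 1 < entry \<pi> i" "entry \<pi> i < entry \<pi> j"
      using ij by (auto simp: lr_max_positions_def)
    \<comment> \<open>Positions count from 1, list indices from 0, and the head is dropped: position
      \<open>i\<close> sits at index \<open>i - 2\<close> of \<open>xs\<close>.\<close>
    moreover from this have "entry \<pi> 1 = x" "entry \<pi> i = xs ! (i - 2)" "entry \<pi> j = xs ! (j - 2)"
      using \<open>i < j\<close> by (simp_all add: entry_def \<pi> nth_Cons')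
    moreover have "sorted_wrt (\<lambda>b c. \<not> (x < b \<and> b < c)) xs"
      using assms by (simp add: \<pi>)
    moreover have "i - 2 < j - 2" "j - 2 < length xs"
      using \<open>1 < i\<close> \<open>i < j\<close> \<open>j \<le> length \<pi>\<close> by (simp_all add: \<pi>)
    ultimately show False
      using sorted_wrt_nth_less[of "\<lambda>b c. \<not> (x < b \<and> b < c)" xs "i - 2" "j - 2"] by simp
  qed
  then have "i = j" if "i \<in> lr_max_positions \<pi> - {1}" "j \<in> lr_max_positions \<pi> - {1}" for i j
    using that by (metis linorder_neqE_nat)
  then have "card (lr_max_positions \<pi> - {1}) \<le> 1"
    by (subst One_nat_def, subst card_le_Suc0_iff_eq) (auto simp: finite_lr_max_positions)
  then show ?thesis
    using card_Diff1_le[of "lr_max_positions \<pi>" 1] card_Diff_singleton_if[of "lr_max_positions \<pi>" 1]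
    by (auto split: if_splits)
qed

text \<open>The first position and that of the maximum are both left-to-right maxima, and nothing
  after the maximum is one. So there is only one exactly when the two coincide.\<close>

lemma num_lr_max_eq_1_iff:
  assumes \<pi>: "\<pi> \<in> perms (Suc n)"
  shows "num_lr_max \<pi> = 1 \<longleftrightarrow> hd \<pi> = Suc n"
proof -
  have len: "length \<pi> = Suc n" using \<pi> by (rule length_perms)
  then have hd: "hd \<pi> = entry \<pi> 1" by (simp add: entry_def hd_conv_nth flip: length_0_conv)
  have set: "set \<pi> = {1..Suc n}" "distinct \<pi>" using \<pi> by (auto simp: perms_iff)
  have le: "entry \<pi> j \<le> Suc n" if "j \<in> {1..Suc n}" for j
    using that set nth_mem[of "j - 1" \<pi>] len by (auto simp: entry_def)
  have "Suc n \<in> set \<pi>" using set by simp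
  then obtain k where k: "k < Suc n" "\<pi> ! k = Suc n" by (metis in_set_conv_nth len)
  have "entry \<pi> j < Suc n" if "j \<in> {1..Suc n}" "j \<noteq> Suc k" for j
  proof -
    have "entry \<pi> j \<noteq> \<pi> ! k"
      using that set(2) k(1) len by (auto simp: entry_def nth_eq_iff_index_eq)
    then show ?thesis using le[OF that(1)] k by simp
  qed
  then have kmax: "Suc k \<in> lr_max_positions \<pi>"
    using k len by (auto simp: lr_max_positions_def entry_def)
  have one: "1 \<in> lr_max_positions \<pi>"
    by (rule one_in_lr_max_positions) (use len in auto)
  show ?thesis
  proof
    assume "num_lr_max \<pi> = 1"
    then have "Suc k = 1" using kmax one by (metis card_1_singletonE singletonD)
    then show "hd \<pi> = Suc n" using k hd by (simp add: entry_def)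
  next
    assume h: "hd \<pi> = Suc n"
    have "j = 1" if "j \<in> lr_max_positions \<pi>" for j
    proof (rule ccontr)
      assume "j \<noteq> 1"
      then have "entry \<pi> 1 < entry \<pi> j" "j \<in> {1..Suc n}"
        using that len by (auto simp: lr_max_positions_def)
      then show False using le[of j] h hd by simp
    qed
    then have "lr_max_positions \<pi> = {1}" using one by auto
    then show "num_lr_max \<pi> = 1" by simp
  qed
qed

text \<open>A leading maximum takes part in no occurrence of 123: this is the insertion of a maximum
  with nothing in front.\<close>

lemma avoiders_hd_max:
  "{\<pi> \<in> avoiders (Suc n) [1, 2, 3]. hd \<pi> = Suc n} = Cons (Suc n) ` avoiders n [1, 2, 3]"
proof -
  have "\<pi> \<in> avoiders (Suc n) [1, 2, 3] \<longleftrightarrow> xs \<in> avoiders n [1, 2, 3]" if "\<pi> = Suc n # xs" for \<pi> xs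
  proof (cases "Suc n \<in> set xs")
    case False
    then have p: "\<pi> \<in> perms (Suc n) \<longleftrightarrow> xs \<in> perms n"
      using insert_max_perms_iff[of n "[]" xs] that by simp
    moreover have "avoids_123 \<pi> \<longleftrightarrow> avoids_123 xs" if "xs \<in> perms n"
      using avoids_123_insert_max[of "[]" xs "Suc n"] that \<open>\<pi> = _\<close> by (auto simp: perms_iff)
    ultimately show ?thesis by (auto simp: avoiders_def contains_123_iff)
  next
    \<comment> \<open>A second \<open>Suc n\<close> refutes both sides: it breaks distinctness in
      rank \<open>Suc n\<close> and is too large for rank \<open>n\<close>.\<close>
    case True
    with that show ?thesis by (auto simp: avoiders_def perms_iff)
  qed
  moreover have "\<pi> \<noteq> []" if "\<pi> \<in> avoiders (Suc n) [1, 2, 3]" for \<pi>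
    using that by (auto simp: avoiders_def perms_iff)
  ultimately show ?thesis
    by (auto simp: image_iff) (metis list.collapse)
qed

section \<open>Distribution and mean of the number of left-to-right maxima\<close>

lemma finite_avoiders: "finite (avoiders n \<rho>)"
  by (simp add: avoiders_def)

lemma card_avoiders_1_lr_max:
  assumes "N \<ge> 1"
  shows "real (card {\<pi> \<in> avoiders N [1, 2, 3]. num_lr_max \<pi> = 1}) = catalan (N - 1)"
proof -
  obtain n where N: "N = Suc n" using assms by (cases N) auto
  have "{\<pi> \<in> avoiders N [1, 2, 3]. num_lr_max \<pi> = 1} = {\<pi> \<in> avoiders N [1, 2, 3]. hd \<pi> = N}"
    using num_lr_max_eq_1_iff by (auto simp: N avoiders_def)
  then show ?thesis
    by (simp add: N avoiders_hd_max card_image card_avoiders)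
qed

lemma num_lr_max_avoiders:
  assumes "N \<ge> 1" "\<pi> \<in> avoiders N [1, 2, 3]"
  shows "num_lr_max \<pi> = 1 \<or> num_lr_max \<pi> = 2"
proof -
  have "avoids_123 \<pi>" "\<pi> \<noteq> []"
    using assms by (auto simp: avoiders_def contains_123_iff perms_iff)
  then show ?thesis using num_lr_max_le_2[of \<pi>] num_lr_max_pos[of \<pi>] by linarith
qed

lemma card_avoiders_2_lr_max:
  assumes "N \<ge> 1"
  shows "real (card {\<pi> \<in> avoiders N [1, 2, 3]. num_lr_max \<pi> = 2}) = catalan N - catalan (N - 1)"
proof -
  let ?A = "\<lambda>m. {\<pi> \<in> avoiders N [1, 2, 3]. num_lr_max \<pi> = m}"
  have "avoiders N [1, 2, 3] = ?A 1 \<union> ?A 2"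
    using num_lr_max_avoiders[OF assms] by auto
  moreover have "card (?A 1 \<union> ?A 2) = card (?A 1) + card (?A 2)"
    by (intro card_Un_disjoint) (auto simp: finite_avoiders)
  ultimately show ?thesis
    using card_avoiders[of N] card_avoiders_1_lr_max[OF assms] by simp
qed

lemma sum_num_lr_max_avoiders:
  assumes "N \<ge> 1"
  shows "(\<Sum>\<pi>\<in>avoiders N [1, 2, 3]. real (num_lr_max \<pi>)) = 2 * catalan N - catalan (N - 1)"
proof -
  let ?S = "avoiders N [1, 2, 3]"
  \<comment> \<open>As only the values 1 and 2 occur, the count is 2 minus the indicator of a single
    maximum.\<close>
  have "(\<Sum>\<pi>\<in>?S. real (num_lr_max \<pi>)) = (\<Sum>\<pi>\<in>?S. 2 - (if num_lr_max \<pi> = 1 then 1 else 0))"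
    by (intro sum.cong) (auto dest: num_lr_max_avoiders[OF assms])
  also have "\<dots> = 2 * catalan N - real (card {\<pi> \<in> ?S. num_lr_max \<pi> = 1})"
    by (simp add: sum_subtractf finite_avoiders card_avoiders flip: sum.inter_filter)
  finally show ?thesis by (simp only: card_avoiders_1_lr_max[OF assms])
qed

lemma avoiders_nonempty: "avoiders n [1, 2, 3] \<noteq> {}"
  using card_avoiders[of n] catalan_pos[of n] by auto

lemma expectation_num_lr_max_avoiders:
  assumes "N \<ge> 1"
  shows "measure_pmf.expectation (pmf_of_set (avoiders N [1, 2, 3])) (\<lambda>\<pi>. real (num_lr_max \<pi>))
    = 2 - catalan (N - 1) / catalan N"
  using sum_num_lr_max_avoiders[OF assms] catalan_pos[of N]
  by (simp add: integral_pmf_of_set avoiders_nonempty finite_avoiders card_avoiders field_simps)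

section \<open>Prefixes\<close>

text \<open>Flattening replaces entries by their ranks; this makes it a strictly increasing
  relabelling, which changes neither further flattenings nor left-to-right maxima.\<close>

lemma rank_strict_mono:
  fixes A :: "nat set"
  assumes "finite A"
  shows "strict_mono_on A (\<lambda>x. card {y \<in> A. y \<le> x})"
proof (intro strict_mono_onI psubset_card_mono)
  fix a b assume "a \<in> A" "b \<in> A" "a < b"
  then have "b \<in> {y \<in> A. y \<le> b} - {y \<in> A. y \<le> a}" "{y \<in> A. y \<le> a} \<subseteq> {y \<in> A. y \<le> b}"
    by auto
  then show "{y \<in> A. y \<le> a} \<subset> {y \<in> A. y \<le> b}" by blast
qed (use assms in simp)

lemma length_flattening [simp]: "length (flattening xs) = length xs"
  by (simp add: flattening_def)

lemma length_flat_prefix [simp]: "length (flat_prefix \<pi> i) = min (length \<pi>) i"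
  by (simp add: flat_prefix_def)

text \<open>The inner flattening relabels the first \<open>i\<close> entries increasingly, which the
  outer one cannot see.\<close>

lemma flat_prefix_flat_prefix:
  assumes "i \<le> j"
  shows "flat_prefix (flat_prefix \<pi> j) i = flat_prefix \<pi> i"
proof -
  let ?f = "\<lambda>x. card {y \<in> set (take j \<pi>). y \<le> x}"
  have "take i (flat_prefix \<pi> j) = map ?f (take i \<pi>)"
    using assms by (simp add: flat_prefix_def flattening_def take_map min_absorb1)
  moreover have "strict_mono_on (set (take i \<pi>)) ?f"
    using assms by (intro monotone_on_subset[OF rank_strict_mono] set_take_subset_set_take) auto
  ultimately show ?thesis
    by (simp add: flat_prefix_def flattening_map)
qed

lemma flattening_perms:
  assumes "\<pi> \<in> perms n"
  shows "flattening \<pi> = \<pi>"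
proof -
  have "{y \<in> {1..n}. y \<le> x} = {1..x}" if "x \<in> {1..n}" for x
    using that by auto
  then show ?thesis using assms
    by (auto simp: flattening_def perms_iff intro!: map_idI)
qed

lemma lr_max_positions_map:
  assumes "strict_mono_on (set xs) f"
  shows "lr_max_positions (map f xs) = lr_max_positions xs"
proof -
  have "entry xs j \<in> set xs" "entry (map f xs) j = f (entry xs j)" if "1 \<le> j" "j \<le> length xs" for j
    using that by (simp_all add: entry_def)
  then show ?thesis
    using strict_mono_on_less[OF assms] by (auto simp: lr_max_positions_def)
qed

text \<open>Being a left-to-right maximum at \<open>j\<close> depends only on the relative order of
  the first \<open>j\<close> entries.\<close>

lemma lr_max_positions_flat_prefix:
  "lr_max_positions (flat_prefix \<pi> i) = lr_max_positions \<pi> \<inter> {..i}"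
proof -
  have "lr_max_positions (flat_prefix \<pi> i) = lr_max_positions (take i \<pi>)"
    unfolding flat_prefix_def flattening_def
    by (intro lr_max_positions_map rank_strict_mono) simp
  also have "\<dots> = lr_max_positions \<pi> \<inter> {..i}"
  proof -
    have "entry (take i \<pi>) j = entry \<pi> j" if "1 \<le> j" "j \<le> i" for j
      using that by (simp add: entry_def)
    then show ?thesis by (auto simp: lr_max_positions_def)
  qed
  finally show ?thesis .
qed

section \<open>Prefixes of one permutation and maximal antichains\<close>

lemma comparable_flat_prefixes:
  assumes "i \<le> j" "j \<le> length \<pi>"
  shows "comparable (flat_prefix \<pi> i) (flat_prefix \<pi> j)"
  using assms by (simp add: comparable_def contains_prefix_def flat_prefix_flat_prefix min_absorb2)

text \<open>Existence: \<open>\<pi>\<close> is itself in the prefix tree, at full size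
  \<open>n\<close>, and an element of \<open>A\<close> comparable to it must be one of its prefixes.
  Uniqueness: two prefixes of \<open>\<pi>\<close> are comparable.\<close>

lemma maximal_antichain_meets_once:
  assumes A: "maximal_antichain n A" and \<pi>: "\<pi> \<in> perms n" "n \<in> lr_max_positions \<pi>"
  shows "\<exists>!i. i \<in> lr_max_positions \<pi> \<and> flat_prefix \<pi> i \<in> A"
proof -
  have len: "length \<pi> = n" using \<pi>(1) by (rule length_perms)
  have n: "n \<ge> 1" using \<pi>(2) by (auto simp: lr_max_positions_def)
  then have "\<pi> \<in> prefix_tree n" using \<pi> by (auto simp: prefix_tree_def)
  then obtain p where p: "p \<in> A" "comparable p \<pi>"
    using A by (auto simp: maximal_antichain_def)
  then obtain i where i: "i \<in> {1..n}" "p \<in> perms i" "i \<in> lr_max_positions p"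
    using A by (auto simp: maximal_antichain_def prefix_tree_def)
  have lp: "length p = i" using i(2) by (rule length_perms)
  have pre: "flat_prefix \<pi> i = p"
  proof (cases "contains_prefix p \<pi>")
    \<comment> \<open>An element of \<open>A\<close> containing \<open>\<pi>\<close> has size at
      most \<open>n\<close>, hence equals \<open>\<pi>\<close>.\<close>
    case True
    then have "i = n" "flat_prefix p n = \<pi>"
      using len lp i by (auto simp: contains_prefix_def)
    then show ?thesis
      using lp len flattening_perms[OF i(2)] flattening_perms[OF \<pi>(1)] by (simp add: flat_prefix_def)
  next
    case False
    then show ?thesis using p lp by (auto simp: comparable_def contains_prefix_def)
  qed
  show ?thesis
  proof (rule ex1I[of _ i])
    show "i \<in> lr_max_positions \<pi> \<and> flat_prefix \<pi> i \<in> A"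
      using i(3) p(1) unfolding pre[symmetric] by (simp add: lr_max_positions_flat_prefix)
  next
    fix j assume j: "j \<in> lr_max_positions \<pi> \<and> flat_prefix \<pi> j \<in> A"
    then have jn: "j \<le> n" using len by (auto simp: lr_max_positions_def)
    have "comparable (flat_prefix \<pi> i) (flat_prefix \<pi> j) \<or> comparable (flat_prefix \<pi> j) (flat_prefix \<pi> i)"
      using comparable_flat_prefixes[of i j \<pi>] comparable_flat_prefixes[of j i \<pi>] i jn len
      by (cases "i \<le> j") auto
    then have "flat_prefix \<pi> j = flat_prefix \<pi> i"
      using A j pre p(1) by (metis maximal_antichain_def)
    then show "j = i"
      using length_flat_prefix[of \<pi> i] length_flat_prefix[of \<pi> j] len jn i by simp
  qed
qed

text \<open>Some maximal antichain must exist for the value described by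
  \<open>win_probability\<close> to be unique; this one means stopping at the first entry.\<close>

lemma maximal_antichain_singleton:
  assumes "n \<ge> 1"
  shows "maximal_antichain n {[1]}"
proof -
  have "[1] \<in> prefix_tree n"
    using assms by (auto simp: prefix_tree_def perms_iff lr_max_positions_def intro!: bexI[of _ 1])
  moreover have "comparable [1] q" if q: "q \<in> prefix_tree n" for q
  proof -
    obtain x xs where "q = x # xs"
      using q by (cases q) (auto simp: prefix_tree_def lr_max_positions_def)
    moreover have "{y. y = x \<and> y \<le> x} = {x}" by auto
    ultimately show ?thesis
      by (simp add: comparable_def contains_prefix_def flat_prefix_def flattening_def)
  qed
  ultimately show ?thesis by (auto simp: maximal_antichain_def)
qed

section \<open>The win probability of a game with a given bine of competitors\<close>

lemma prob_pmf_of_multiset: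
  assumes "M \<noteq> {#}"
  shows "measure_pmf.prob (pmf_of_multiset M) {x. P x} = real (size (filter_mset P M)) / real (size M)"
proof -
  have "measure_pmf.prob (pmf_of_multiset M) {x. P x}
      = measure_pmf.prob (pmf_of_multiset M) ({x. P x} \<inter> set_pmf (pmf_of_multiset M))"
    by (rule measure_Int_set_pmf[symmetric])
  also have "\<dots> = (\<Sum>x\<in>set_mset (filter_mset P M). count M x / size M)"
    using assms by (subst measure_measure_pmf_finite) (auto intro!: sum.cong)
  also have "\<dots> = (\<Sum>x\<in>set_mset (filter_mset P M). real (count (filter_mset P M) x)) / size M"
    by (subst sum_divide_distrib) (auto intro!: sum.cong)
  also have "\<dots> = real (size (filter_mset P M)) / size M"
    by (simp add: size_multiset_overloaded_eq)
  finally show ?thesis .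
qed

text \<open>The relator matches elements one by one; this carries the count of wins over to pairs of
  a competitor and a position.\<close>

lemma size_filter_rel_mset:
  assumes "rel_mset R M N" "\<And>x y. x \<in># M \<Longrightarrow> R x y \<Longrightarrow> P x \<longleftrightarrow> Q y"
  shows "size (filter_mset P M) = size (filter_mset Q N)"
  using assms by (induction rule: rel_mset_induct) auto

lemma rel_mset_right_elem:
  assumes "rel_mset R M N" "y \<in># N"
  shows "\<exists>x. x \<in># M \<and> R x y"
  using assms by (induction rule: rel_mset_induct) auto

text \<open>\<open>n\<close> occurs in \<open>\<sigma>\<close> only at position \<open>j\<close>, so
  a win is a stop at \<open>j\<close>. Up to \<open>j\<close> the prefixes are those of
  \<open>\<pi>\<close>, and if the one at \<open>j\<close> lies in the antichain \<open>A\<close>,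
  no shorter one does.\<close>

lemma wins_insertable_iff:
  assumes A: "maximal_antichain n A" and \<pi>: "\<pi> \<in> perms n" "n \<in> lr_max_positions \<pi>"
    and j: "j \<in> lr_max_positions \<pi>" and ins: "insertable n (\<pi>, j) \<sigma>"
  shows "wins n A \<sigma> \<longleftrightarrow> flat_prefix \<pi> j \<in> A"
proof -
  have \<sigma>: "\<sigma> \<in> perms n" "flat_prefix \<sigma> j = flat_prefix \<pi> j" "entry \<sigma> j = n"
    using ins by (auto simp: insertable_def)
  have len: "length \<sigma> = n" "length \<pi> = n" using \<sigma>(1) \<pi>(1) by (auto intro: length_perms)
  have jn: "j \<in> {1..n}" using j len by (auto simp: lr_max_positions_def)
  have pre: "flat_prefix \<sigma> i = flat_prefix \<pi> i" if "i \<le> j" for i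
    using flat_prefix_flat_prefix[OF that, of \<sigma>] flat_prefix_flat_prefix[OF that, of \<pi>] \<sigma>(2) by simp
  have uniq: "i = j" if "i \<in> {1..n}" "entry \<sigma> i = n" for i
  proof -
    have "distinct \<sigma>" using \<sigma>(1) by (simp add: perms_iff)
    moreover have "i - 1 < n" "j - 1 < n" using that jn by auto
    ultimately have "i - 1 = j - 1"
      using that len \<sigma>(3) nth_eq_iff_index_eq[of \<sigma> "i - 1" "j - 1"] by (simp add: entry_def)
    then show ?thesis using that jn by auto
  qed
  have "flat_prefix \<pi> i \<notin> A" if "flat_prefix \<pi> j \<in> A" "i \<in> {1..<j}" for i
  proof
    assume "flat_prefix \<pi> i \<in> A"
    moreover have "comparable (flat_prefix \<pi> i) (flat_prefix \<pi> j)"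
      using that jn len by (intro comparable_flat_prefixes) auto
    ultimately have "flat_prefix \<pi> i = flat_prefix \<pi> j"
      using A that by (metis maximal_antichain_def)
    then show False
      using length_flat_prefix[of \<pi> i] length_flat_prefix[of \<pi> j] that jn len by simp
  qed
  then have "wins n A \<sigma>" if "flat_prefix \<pi> j \<in> A"
    unfolding wins_def using that jn pre \<sigma>(3) by (intro bexI[of _ j]) simp_all
  moreover have "flat_prefix \<pi> j \<in> A" if win: "wins n A \<sigma>"
  proof -
    obtain i where "i \<in> {1..n}" "flat_prefix \<sigma> i \<in> A" "entry \<sigma> i = n"
      using win unfolding wins_def by blast
    with uniq[of i] \<sigma>(2) show ?thesis by simp
  qed
  ultimately show ?thesis by blast
qed

lemma in_lr_max_pairs_iff: "x \<in># lr_max_pairs \<J> \<longleftrightarrow> fst x \<in># \<J> \<and> snd x \<in> lr_max_positions (fst x)"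
  by (cases x) (auto simp: lr_max_pairs_def finite_lr_max_positions)

lemma size_filter_lr_max_pairs:
  "size (filter_mset P (lr_max_pairs \<J>)) = (\<Sum>\<pi>\<in>#\<J>. card {i \<in> lr_max_positions \<pi>. P (\<pi>, i)})"
  by (induction \<J>) (simp_all add: lr_max_pairs_def filter_mset_image_mset finite_lr_max_positions)

lemma lr_max_positions_append_max:
  assumes "\<pi> \<in> perms m"
  shows "lr_max_positions (\<pi> @ [Suc m]) = insert (Suc m) (lr_max_positions \<pi>)"
proof -
  have len: "length \<pi> = m" using assms by (rule length_perms)
  have "\<pi> ! i < Suc m" if "i < m" for i
    using that assms len nth_mem[of i \<pi>] by (auto simp: perms_iff)
  then show ?thesis using len
    by (auto simp: lr_max_positions_def entry_def nth_append)
qed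

lemma append_max_perms: "\<pi> \<in> perms m \<Longrightarrow> \<pi> @ [Suc m] \<in> perms (Suc m)"
  by (auto simp: perms_iff)

section \<open>A game with a fixed bine of competitors\<close>

context
  fixes m :: nat and \<J> \<I> :: "nat list multiset"
  assumes game: "bine_game (Suc m) \<J> \<I>"
begin

lemma bine_game_competitors: "\<J> \<noteq> {#}" "\<And>\<pi>. \<pi> \<in># \<J> \<Longrightarrow> \<pi> \<in> perms m"
  using game by (auto simp: bine_game_def)

lemma bine_game_rel:
  "rel_mset (insertable (Suc m)) (lr_max_pairs (image_mset (\<lambda>\<pi>. \<pi> @ [Suc m]) \<J>)) \<I>"
  using game by (simp add: bine_game_def)

text \<open>One permutation is derived from each left-to-right maximum of a competitor after
  \<open>Suc m\<close> is appended; the appended entry accounts for the \<open>+ 1\<close>.\<close>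

lemma size_bine_game: "size \<I> = (\<Sum>\<pi>\<in>#\<J>. num_lr_max \<pi> + 1)"
proof -
  have "num_lr_max (\<pi> @ [Suc m]) = num_lr_max \<pi> + 1" if "\<pi> \<in># \<J>" for \<pi>
  proof -
    have "Suc m \<notin> lr_max_positions \<pi>"
      using length_perms[OF bine_game_competitors(2)[OF that]] by (auto simp: lr_max_positions_def)
    then show ?thesis
      by (simp add: lr_max_positions_append_max[OF bine_game_competitors(2)[OF that]] finite_lr_max_positions)
  qed
  then have "(\<Sum>\<pi>\<in>#image_mset (\<lambda>\<pi>. \<pi> @ [Suc m]) \<J>. num_lr_max \<pi>) = (\<Sum>\<pi>\<in>#\<J>. num_lr_max \<pi> + 1)"
    by (auto simp: multiset.map_comp intro!: arg_cong[of _ _ sum_mset] image_mset_cong)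
  then show ?thesis
    using rel_mset_size[OF bine_game_rel]
      size_filter_lr_max_pairs[of "\<lambda>_. True" "image_mset (\<lambda>\<pi>. \<pi> @ [Suc m]) \<J>"] by simp
qed

lemma bine_game_is_game: "best_choice_game (Suc m) \<I>"
proof -
  have "size \<I> \<noteq> 0"
    using size_bine_game bine_game_competitors(1) by (cases \<J>) auto
  moreover have "\<sigma> \<in> perms (Suc m)" if "\<sigma> \<in># \<I>" for \<sigma>
    using rel_mset_right_elem[OF bine_game_rel that] by (auto simp: insertable_def)
  ultimately show ?thesis by (auto simp: best_choice_game_def)
qed

lemma strike_prob_bine_game:
  assumes "maximal_antichain (Suc m) A"
  shows "strike_prob (Suc m) \<I> A = real (size \<J>) / real (\<Sum>\<pi>\<in>#\<J>. num_lr_max \<pi> + 1)"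
proof -
  let ?J = "image_mset (\<lambda>\<pi>. \<pi> @ [Suc m]) \<J>"
  have J: "\<pi> \<in> perms (Suc m)" "Suc m \<in> lr_max_positions \<pi>" if "\<pi> \<in># ?J" for \<pi>
    using that bine_game_competitors(2) append_max_perms lr_max_positions_append_max by auto
  \<comment> \<open>The arbitrary choices drop out here: whether a derived permutation is won
    depends only on its pair.\<close>
  have "size (filter_mset (wins (Suc m) A) \<I>)
      = size (filter_mset (\<lambda>(\<pi>, i). flat_prefix \<pi> i \<in> A) (lr_max_pairs ?J))"
  proof (rule size_filter_rel_mset[OF bine_game_rel, symmetric], clarify)
    fix \<pi> i \<sigma> assume "(\<pi>, i) \<in># lr_max_pairs ?J" and ins: "insertable (Suc m) (\<pi>, i) \<sigma>"
    then have "\<pi> \<in># ?J" "i \<in> lr_max_positions \<pi>" by (simp_all only: in_lr_max_pairs_iff fst_conv snd_conv)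
    then show "flat_prefix \<pi> i \<in> A \<longleftrightarrow> wins (Suc m) A \<sigma>"
      using wins_insertable_iff[OF assms J _ ins] by blast
  qed
  also have "\<dots> = (\<Sum>\<pi>\<in>#?J. card {i \<in> lr_max_positions \<pi>. flat_prefix \<pi> i \<in> A})"
    by (simp add: size_filter_lr_max_pairs)
  \<comment> \<open>The antichain contains exactly one prefix of each competitor, so each
    contributes a single win.\<close>
  also have "\<dots> = (\<Sum>\<pi>\<in>#?J. 1)"
  proof (intro arg_cong[of _ _ sum_mset] image_mset_cong)
    fix \<pi> assume "\<pi> \<in># ?J"
    from maximal_antichain_meets_once[OF assms J[OF this]]
    show "card {i \<in> lr_max_positions \<pi>. flat_prefix \<pi> i \<in> A} = 1"
      by (auto simp: card_1_singleton_iff One_nat_def)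
  qed
  also have "\<dots> = size \<J>" by simp
  finally have "size (filter_mset (wins (Suc m) A) \<I>) = size \<J>" .
  moreover have "\<I> \<noteq> {#}"
    using bine_game_is_game by (simp add: best_choice_game_def)
  ultimately show ?thesis
    unfolding strike_prob_def size_bine_game[symmetric] by (simp add: prob_pmf_of_multiset)
qed

lemma strategy_indifferent_bine_game: "strategy_indifferent (Suc m) \<I>"
  using bine_game_is_game strike_prob_bine_game by (simp add: strategy_indifferent_def)

lemma win_probability_bine_game:
  "win_probability (Suc m) \<I> = real (size \<J>) / real (\<Sum>\<pi>\<in>#\<J>. num_lr_max \<pi> + 1)"
  unfolding win_probability_def
  by (rule the_equality) (use strike_prob_bine_game maximal_antichain_singleton[of "Suc m"] in auto)

end

lemma win_probability_avoiders:
  assumes "N \<ge> 1" "bine_game (N + 1) (mset_set (avoiders N [1, 2, 3])) \<I>"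
  shows "win_probability (N + 1) \<I> = 1 / (3 - catalan (N - 1) / catalan N)"
proof -
  \<comment> \<open>The avoiders have \<open>2 * catalan N - catalan (N - 1)\<close> left-to-right
    maxima in all, and each of the \<open>catalan N\<close> competitors adds one for its appended
    maximum.\<close>
  have sum: "real (\<Sum>\<pi>\<in>#mset_set (avoiders N [1, 2, 3]). num_lr_max \<pi> + 1) = 3 * catalan N - catalan (N - 1)"
    using sum_num_lr_max_avoiders[OF assms(1)]
    unfolding sum_unfold_sum_mset[symmetric] by (simp add: sum.distrib card_avoiders)
  have "win_probability (N + 1) \<I> = catalan N / (3 * catalan N - catalan (N - 1))"
    using win_probability_bine_game[of N _ \<I>] assms(2)
    unfolding Suc_eq_plus1 by (simp only: sum size_mset_set card_avoiders)
  also have "\<dots> = 1 / (3 - catalan (N - 1) / catalan N)"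
    using catalan_pos[of N] by (simp add: field_simps)
  finally show ?thesis .
qed

theorem mainTheorem8:
  shows "(\<forall>N\<ge>1.
            (\<forall>\<pi>\<in>avoiders N [1,2,3]. num_lr_max \<pi> \<le> 2) \<and>
            real (card {\<pi> \<in> avoiders N [1,2,3]. num_lr_max \<pi> = 1}) = catalan (N - 1) \<and>
            real (card {\<pi> \<in> avoiders N [1,2,3]. num_lr_max \<pi> = 2}) = catalan N - catalan (N - 1) \<and>
            measure_pmf.expectation (pmf_of_set (avoiders N [1,2,3])) (\<lambda>\<pi>. real (num_lr_max \<pi>))
              = 2 - catalan (N - 1) / catalan N) \<and>
         (\<forall>\<I>. (\<forall>N\<ge>1. bine_game (N + 1) (mset_set (avoiders N [1,2,3])) (\<I> N)) \<longrightarrow>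
            (\<forall>N\<ge>1. strategy_indifferent (N + 1) (\<I> N)) \<and>
            (\<lambda>N. win_probability (N + 1) (\<I> N)) \<longlonglongrightarrow> 4 / 11)"
proof (intro conjI allI impI)
  fix N :: nat assume "N \<ge> 1"
  then show "\<forall>\<pi>\<in>avoiders N [1,2,3]. num_lr_max \<pi> \<le> 2"
    by (auto dest: num_lr_max_avoiders)
next
  fix \<I> assume game: "\<forall>N\<ge>1. bine_game (N + 1) (mset_set (avoiders N [1,2,3])) (\<I> N)"
  show "strategy_indifferent (N + 1) (\<I> N)" if "N \<ge> 1" for N
    using strategy_indifferent_bine_game game that by (metis Suc_eq_plus1)
  have "(\<lambda>N. 1 / (3 - catalan (N - 1) / catalan N)) \<longlonglongrightarrow> 1 / (3 - 1 / 4)"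
    by (intro tendsto_intros catalan_ratio_tendsto) simp
  \<comment> \<open>The closed form is available for \<open>N \<ge> 1\<close>, so the two sequences
    agree eventually.\<close>
  moreover have "\<forall>\<^sub>F N in sequentially.
      1 / (3 - catalan (N - 1) / catalan N) = win_probability (N + 1) (\<I> N)"
    using eventually_ge_at_top[of 1] by eventually_elim (simp only: win_probability_avoiders game)
  ultimately have "(\<lambda>N. win_probability (N + 1) (\<I> N)) \<longlonglongrightarrow> 1 / (3 - 1 / 4)"
    by (rule Lim_transform_eventually)
  then show "(\<lambda>N. win_probability (N + 1) (\<I> N)) \<longlonglongrightarrow> 4 / 11" by simp
qed (fact card_avoiders_1_lr_max card_avoiders_2_lr_max expectation_num_lr_max_avoiders)+

end
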